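(* Let $h$ be a fixed positive integer and let $$S(x;h):=\sum_{1\le n\le x,\ n\neq h} d(n)\,d(n-h)\,d(n+h).$$ Then, as $x\to\infty$, $S(x;h)\ll_h x(\log x)^3$, i.e. there is a constant $C_h>0$ depending only on $h$ such that $S(x;h)\le C_h\,x(\log x)^3$ for all sufficiently large $x$.
   Context: For a nonzero integer $m$, $d(m)$ denotes the number of positive divisors of $m$ (so $d(m)=d(|m|)$). *)

theory Defs
  imports "HOL-Analysis.Analysis"
begin

definition ndiv :: "int \<Rightarrow> nat" where
  "ndiv m = card {k::nat. k > 0 \<and> int k dvd m}"

definition S :: "real \<Rightarrow> int \<Rightarrow> real" where
  "S x h = (\<Sum>n\<in>{n::int. 1 \<le> n \<and> real_of_int n \<le> x \<and> n \<noteq> h}.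
              real (ndiv n * ndiv (n - h) * ndiv (n + h)))"

end

theory Submission
  imports Defs "HOL-Computational_Algebra.Primes"
begin

text \<open>
  Let \<open>N = x + h\<close> and \<open>y = N\<^sup>1\<^sup>/\<^sup>3\<close>. It suffices to find weights \<open>g \<ge> 0\<close> with
  \<open>d(m) \<le> \<Sum> g(a)\<close> over the divisors \<open>a \<le> y\<close> of every \<open>m \<le> N\<close> and \<open>\<Sum>\<^sub>a\<^sub>\<le>\<^sub>y g(a)/a \<lless> log N\<close>:
  after inserting this for \<open>n\<close>, \<open>n - h\<close>, \<open>n + h\<close> and interchanging the sums, one counts the \<open>n \<le> x\<close>
  in three simultaneous residue classes, whose moduli have product at most \<open>N\<close> and are pairwise coprime
  up to divisors of \<open>2h\<close>.

  To find \<open>g\<close>, multiply the primes of \<open>m\<close> in increasing order as long as the product \<open>a\<close> stays at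
  most \<open>y\<close>, and write \<open>m = ab\<close> with \<open>q\<close> the least prime factor of \<open>b\<close>. Then \<open>d(b) \<le> 2\<^sup>u\<close> with
  \<open>u = log N / log q\<close>. If \<open>u < 6\<close>, a constant weight is enough. Otherwise \<open>a > y\<^sup>1\<^sup>/\<^sup>2\<close>, and at least
  half of the divisors of \<open>a\<close> exceed \<open>y\<^sup>1\<^sup>/\<^sup>4\<close>; these are \<open>q\<close>-smooth, hence so rare (Rankin's trick)
  that the factor \<open>2\<^sup>u\<close> is affordable. For bounded \<open>q\<close> the bound \<open>d(m) \<lless> m\<^sup>1\<^sup>/\<^sup>2\<^sup>4\<close> is used instead.

  The sums of \<open>d\<^sup>t\<^sup>-\<^sup>1\<close> over smooth \<open>d\<close> are controlled by a differential inequality in \<open>t\<close>,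
  which needs no more prime number theory than \<open>\<Sum>\<^sub>p\<^sub>\<le>\<^sub>z log p / p \<lless> log z\<close>.
\<close>

section \<open>Elementary bounds for the divisor function\<close>

definition num_divisors :: "nat \<Rightarrow> nat" where
  "num_divisors n = card {d. d dvd n}"

lemma finite_divisors: "n > 0 \<Longrightarrow> finite {d. d dvd (n::nat)}"
  by (rule finite_subset[of _ "{..n}"]) (auto dest: dvd_imp_le)

text \<open>Every divisor of \<open>a * b\<close> is a divisor of \<open>a\<close> times a divisor
  of \<open>b\<close>, so multiplication maps the pairs onto the divisors.\<close>

lemma num_divisors_mult_le:
  assumes "a > 0" "b > 0"
  shows "num_divisors (a * b) \<le> num_divisors a * num_divisors b"
proof -
  have "{d. d dvd a * b} \<subseteq> (\<lambda>(x, y). x * y) ` ({d. d dvd a} \<times> {d. d dvd b})"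
    by (auto simp: image_iff dest!: division_decomp)
  then have "card {d. d dvd a * b} \<le> card ({d. d dvd a} \<times> {d. d dvd b})"
    using assms by (intro surj_card_le) (auto simp: finite_divisors)
  then show ?thesis
    by (simp add: num_divisors_def card_cartesian_product)
qed

lemma num_divisors_prime_power:
  assumes "prime p"
  shows "num_divisors (p ^ k) = k + 1"
proof -
  have "{d. d dvd p ^ k} = (\<lambda>i. p ^ i) ` {..k}"
    using assms by (auto simp: divides_primepow_nat le_imp_power_dvd)
  moreover have "inj_on (\<lambda>i. p ^ i) {..k}"
    using prime_gt_1_nat[OF assms] by (auto simp: inj_on_def)
  ultimately show ?thesis
    by (simp add: num_divisors_def card_image)
qed

lemma num_divisors_1 [simp]: "num_divisors 1 = 1" "num_divisors (Suc 0) = 1"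
  by (simp_all add: num_divisors_def)

text \<open>Split off one prime \<open>p\<close> at a time: it at most doubles the number of
  divisors, and \<open>p powr e\<close> pays for this 2.\<close>

lemma num_divisors_le_powr_of_rough:
  fixes e :: real
  assumes "n > 0" "\<And>p. prime p \<Longrightarrow> p dvd n \<Longrightarrow> real p powr e \<ge> 2"
  shows "real (num_divisors n) \<le> real n powr e"
  using assms
proof (induction n rule: less_induct)
  case (less n)
  show ?case
  proof (cases "n = 1")
    case True
    then show ?thesis by simp
  next
    case False
    then obtain p where p: "prime p" "p dvd n"
      using prime_factor_nat by blast
    then obtain m where m: "n = p * m" by auto
    have "m > 0" "m < n" 
      using less.prems(1) m prime_gt_1_nat[OF p(1)] by auto
    have "real (num_divisors m) \<le> real m powr e"
      using \<open>m > 0\<close> \<open>m < n\<close> less.prems(2) m by (intro less.IH) auto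
    moreover have "num_divisors n \<le> 2 * num_divisors m"
      using num_divisors_mult_le[of p m] num_divisors_prime_power[OF p(1), of 1] \<open>m > 0\<close> p(1) m
      by (simp add: prime_gt_0_nat)
    ultimately have "real (num_divisors n) \<le> 2 * real m powr e"
      by linarith
    also have "\<dots> \<le> real p powr e * real m powr e"
      using less.prems(2)[OF p] by (intro mult_right_mono) auto
    also have "\<dots> = real n powr e"
      by (simp add: m powr_mult)
    finally show ?thesis .
  qed
qed

lemma num_divisors_le_powr:
  fixes e :: real
  assumes "e > 0"
  obtains K where "K > 0" "\<And>n. n > 0 \<Longrightarrow> real (num_divisors n) \<le> K * real n powr e"
proof -
  define Q where "Q = nat \<lceil>2 powr (1 / e)\<rceil>"
  have Q: "real p powr e \<ge> 2" if "p \<ge> Q" for p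
  proof -
    have "2 powr (1 / e) \<le> real p"
      using that by (simp add: Q_def nat_le_iff ceiling_le_iff)
    then have "(2 powr (1 / e)) powr e \<le> real p powr e"
      using assms by (intro powr_mono2) auto
    then show ?thesis using assms by (simp add: powr_powr)
  qed
  have "\<exists>K>0. \<forall>n>0. (\<forall>p. prime p \<longrightarrow> p dvd n \<longrightarrow> p < P \<or> p \<ge> Q) \<longrightarrow>
          real (num_divisors n) \<le> K * real n powr e" for P
  proof (induction P)
    case 0
    show ?case
      by (rule exI[of _ 1]) (auto intro!: num_divisors_le_powr_of_rough Q)
  next
    case (Suc P)
    then obtain K where K: "K > 0" "\<And>n. n > 0 \<Longrightarrow>
        (\<And>p. prime p \<Longrightarrow> p dvd n \<Longrightarrow> p < P \<or> p \<ge> Q) \<Longrightarrow>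
        real (num_divisors n) \<le> K * real n powr e" by metis
    \<comment> \<open>\<open>c\<close> is the cost of one prime: with
      \<open>t = k * (e * ln 2)\<close> one has
      \<open>k + 1 = 1 + t / (e * ln 2) \<le> c * exp t\<close>, and
      \<open>exp t \<le> P powr (k * e)\<close>.\<close>
    define c where "c = 1 + 1 / (e * ln 2)"
    have c: "c \<ge> 1" using assms by (simp add: c_def)
    have step: "real (num_divisors n) \<le> c * K * real n powr e"
      if n: "n > 0" "\<And>p. prime p \<Longrightarrow> p dvd n \<Longrightarrow> p < Suc P \<or> p \<ge> Q" for n
    proof (cases "prime P")
      case False
      then have "real (num_divisors n) \<le> K * real n powr e"
        using n by (intro K(2)) (auto simp: less_Suc_eq)
      also have "\<dots> \<le> c * (K * real n powr e)"
        using c K(1) mult_right_mono[of 1 c "K * real n powr e"] by simp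
      finally show ?thesis by (simp add: mult_ac)
    next
      case True
      define k where "k = multiplicity P n"
      obtain m where m: "n = P ^ k * m" "\<not> P dvd m"
        using n(1) True multiplicity_decompose'[of n P] unfolding k_def
        by (metis not_prime_unit not_gr0)
      have "m > 0" using n(1) m(1) by (cases m) auto
      have Pm: "P \<ge> 2" using True by (simp add: prime_ge_2_nat)
      have "real (num_divisors m) \<le> K * real m powr e"
        using n(2) m \<open>m > 0\<close> by (intro K(2)) (simp, metis dvd_mult less_SucE)
      moreover have "real (num_divisors n) \<le> real (k + 1) * real (num_divisors m)"
        using num_divisors_mult_le[of "P ^ k" m] num_divisors_prime_power[OF True, of k]
          \<open>m > 0\<close> Pm m(1) by (metis of_nat_le_iff of_nat_mult zero_less_power zero_less_numeral order_less_le_trans)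
      moreover have "real (k + 1) \<le> c * real (P ^ k) powr e"
      proof -
        define t where "t = real k * (e * ln 2)"
        have t: "t \<ge> 0" using assms by (simp add: t_def)
        have "real (k + 1) = 1 + 1 / (e * ln 2) * t"
          using assms by (simp add: t_def)
        also have "\<dots> \<le> 1 * exp t + 1 / (e * ln 2) * exp t"
          using assms t exp_ge_add_one_self[of t] order_trans[of t "1 + t" "exp t"]
          by (intro add_mono mult_left_mono) auto
        also have "\<dots> = c * exp t" by (simp add: c_def algebra_simps)
        also have "exp t = 2 powr (real k * e)" by (simp add: t_def powr_def)
        also have "\<dots> \<le> real P powr (real k * e)"
          using Pm assms by (intro powr_mono2) auto
        also have "\<dots> = real (P ^ k) powr e"
          using Pm by (simp add: powr_powr flip: powr_realpow)
        finally show ?thesis using c by (simp add: mult_left_mono)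
      qed
      ultimately have "real (num_divisors n) \<le> (c * real (P ^ k) powr e) * (K * real m powr e)"
        by (meson mult_mono of_nat_0_le_iff order_trans c powr_ge_zero mult_nonneg_nonneg zero_le_one)
      also have "\<dots> = c * K * real n powr e"
        by (simp add: m(1) powr_mult)
      finally show ?thesis .
    qed
    show ?case
      using step c K(1) by (intro exI[of _ "c * K"]) auto
  qed
  from this[of Q] obtain K where "K > 0" and K: "\<And>n. n > 0 \<Longrightarrow>
      (\<And>p. prime p \<Longrightarrow> p dvd n \<Longrightarrow> p < Q \<or> p \<ge> Q) \<Longrightarrow>
      real (num_divisors n) \<le> K * real n powr e"
    by metis
  have "real (num_divisors n) \<le> K * real n powr e" if "n > 0" for n
    using that by (intro K) auto
  with \<open>K > 0\<close> show ?thesis using that by blast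
qed

text \<open>The complementary divisor \<open>a div d\<close> sends the divisors below the square
  root of \<open>a\<close> injectively to those above it.\<close>

lemma num_divisors_le_large_divisors:
  assumes "a > 0"
  shows "num_divisors a \<le> 2 * card {d. d dvd a \<and> a \<le> d ^ 2}"
proof -
  have fin: "finite {d. d dvd a}" using assms by (rule finite_divisors)
  have "card {d. d dvd a \<and> d ^ 2 < a} \<le> card {d. d dvd a \<and> a \<le> d ^ 2}"
  proof (rule card_inj_on_le[of "\<lambda>d. a div d"])
    show "inj_on (\<lambda>d. a div d) {d. d dvd a \<and> d\<^sup>2 < a}"
      using assms by (intro inj_on_inverseI[of _ "\<lambda>d. a div d"]) (auto elim!: dvdE)
    show "(\<lambda>d. a div d) ` {d. d dvd a \<and> d\<^sup>2 < a} \<subseteq> {d. d dvd a \<and> a \<le> d\<^sup>2}"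
    proof clarify
      fix d assume d: "d dvd a" "d\<^sup>2 < a"
      then obtain e where e: "a = d * e" by auto
      then have "d > 0" using assms by auto
      with d e have "d < e" by (simp add: power2_eq_square)
      with e \<open>d > 0\<close> show "a div d dvd a \<and> a \<le> (a div d)\<^sup>2"
        by (simp add: power2_eq_square)
    qed
  qed (use fin in auto)
  moreover have "{d. d dvd a} = {d. d dvd a \<and> d ^ 2 < a} \<union> {d. d dvd a \<and> a \<le> d ^ 2}"
    by auto
  then have "num_divisors a \<le> card {d. d dvd a \<and> d ^ 2 < a} + card {d. d dvd a \<and> a \<le> d ^ 2}"
    unfolding num_divisors_def by (metis card_Un_le)
  ultimately show ?thesis by linarith
qed

text \<open>Let \<open>a\<close> be the largest divisor of \<open>m\<close> up to \<open>y\<close>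
  whose primes do not exceed those of the cofactor \<open>b\<close>. Appending the least prime
  \<open>q\<close> of \<open>b\<close> preserves this ordering, so maximality forces
  \<open>a * q\<close> beyond \<open>y\<close>.\<close>

lemma maximal_prime_prefix:
  fixes m :: nat and y :: real
  assumes "m > 0" "y \<ge> 1"
  obtains a b where "m = a * b" "real a \<le> y"
    "\<And>p q. prime p \<Longrightarrow> prime q \<Longrightarrow> p dvd a \<Longrightarrow> q dvd b \<Longrightarrow> p \<le> q"
    "b = 1 \<or> (\<exists>q. prime q \<and> q dvd b \<and> (\<forall>p. prime p \<longrightarrow> p dvd b \<longrightarrow> q \<le> p) \<and> y < real (a * q))"
proof -
  define good where "good a \<longleftrightarrow> a dvd m \<and> real a \<le> y \<and>
      (\<forall>p q. prime p \<longrightarrow> prime q \<longrightarrow> p dvd a \<longrightarrow> q dvd m div a \<longrightarrow> p \<le> q)" for a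
  have fin: "finite {a. good a}"
    by (rule finite_subset[OF _ finite_divisors[OF assms(1)]]) (auto simp: good_def)
  have "good 1" using assms by (auto simp: good_def)
  define a where "a = Max {a. good a}"
  have a: "good a"
    using Max_in[OF fin] \<open>good 1\<close> unfolding a_def by blast
  have amax: "a' \<le> a" if "good a'" for a'
    unfolding a_def using fin that by (intro Max_ge) auto
  define b where "b = m div a"
  have mab: "m = a * b" using a by (simp add: good_def b_def)
  have "a > 0" "b > 0" using mab assms(1) by auto
  have ord: "p \<le> q" if "prime p" "prime q" "p dvd a" "q dvd b" for p q
    using a that by (auto simp: good_def b_def)
  have "\<exists>q. prime q \<and> q dvd b \<and> (\<forall>p. prime p \<longrightarrow> p dvd b \<longrightarrow> q \<le> p) \<and> y < real (a * q)" if "b \<noteq> 1"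
  proof -
    define q where "q = (LEAST p. prime p \<and> p dvd b)"
    have q: "prime q" "q dvd b"
      using LeastI_ex[of "\<lambda>p. prime p \<and> p dvd b"] prime_factor_nat[OF that] unfolding q_def by auto
    have qmin: "q \<le> p" if "prime p" "p dvd b" for p
      unfolding q_def using that by (intro Least_le) auto
    obtain c where c: "b = q * c" using q(2) by auto
    have "y < real (a * q)"
    proof (rule ccontr)
      assume "\<not> y < real (a * q)"
      moreover have "m div (a * q) = c"
        using mab c \<open>a > 0\<close> \<open>b > 0\<close> by auto
      moreover have "p \<le> r" if "prime p" "prime r" "p dvd a * q" "r dvd c" for p r
      proof -
        have "p \<le> q"
          using that q ord[of p q] by (auto simp: prime_dvd_mult_iff dest: primes_dvd_imp_eq)
        also have "q \<le> r" using that c by (intro qmin) auto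
        finally show ?thesis .
      qed
      ultimately have "good (a * q)"
        using mab c by (auto simp: good_def)
      then have "a * q \<le> a" by (rule amax)
      then show False using prime_gt_1_nat[OF q(1)] \<open>a > 0\<close> by simp
    qed
    then show ?thesis using q qmin by blast
  qed
  then show ?thesis
    using that[of a b] mab a ord unfolding good_def by blast
qed

section \<open>Chebyshev and Mertens upper bounds for primes\<close>

lemma prod_primes_dvd:
  fixes m :: nat
  assumes "finite P" "\<And>p. p \<in> P \<Longrightarrow> prime p \<and> p dvd m"
  shows "\<Prod>P dvd m"
  using assms
proof (induction P rule: finite_induct)
  case empty
  then show ?case by simp
next
  case (insert p P)
  have "coprime p (\<Prod>P)"
    using insert by (intro prod_coprime_right) (auto intro: primes_coprime)
  then show ?case
    using insert by (simp add: divides_mult)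
qed

text \<open>Chebyshev's argument: the primes between \<open>n\<close> and \<open>2 * n\<close> all
  divide the central binomial coefficient, which is at most \<open>4 ^ n\<close>.\<close>

lemma sum_ln_primes_dyadic_le:
  assumes "n > 0"
  shows "(\<Sum>p | prime p \<and> n < p \<and> p \<le> 2 * n. ln (real p)) \<le> real n * ln 4"
proof -
  define P where "P = {p. prime p \<and> n < p \<and> p \<le> 2 * n}"
  have fin: "finite P" unfolding P_def by (rule finite_subset[of _ "{..2*n}"]) auto
  have "p dvd (2 * n choose n)" if "p \<in> P" for p
  proof -
    have p: "prime p" "n < p" "p \<le> 2 * n" using that by (auto simp: P_def)
    \<comment> \<open>This product is \<open>fact (2 * n)\<close>, which
      \<open>p \<le> 2 * n\<close> divides, whereas \<open>p > n\<close> does not divide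
      \<open>fact n\<close>.\<close>
    have "p dvd fact n * fact (2 * n - n) * (2 * n choose n)"
      using p by (subst binomial_fact_lemma) (auto simp: prime_dvd_fact_iff)
    then show ?thesis
      using p by (auto simp: prime_dvd_mult_iff prime_dvd_fact_iff)
  qed
  then have "\<Prod>P dvd (2 * n choose n)"
    using fin by (intro prod_primes_dvd) (auto simp: P_def)
  then have "\<Prod>P \<le> (2 * n choose n)"
    by (rule dvd_imp_le) simp
  also have "\<dots> \<le> 2 ^ (2 * n)" by (rule binomial_le_pow2)
  finally have le: "real (\<Prod>P) \<le> 4 ^ n"
    by (simp add: power_mult flip: of_nat_le_iff[where 'a = real])
  have pos: "0 < real p" if "p \<in> P" for p using that by (auto simp: P_def prime_gt_0_nat)
  have "(\<Sum>p\<in>P. ln (real p)) = ln (\<Prod>p\<in>P. real p)"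
    using pos fin by (intro ln_prod[symmetric]) auto
  also have "\<dots> \<le> ln (4 ^ n)"
    using le pos by (subst ln_le_cancel_iff) (auto intro!: prod_pos)
  also have "\<dots> = real n * ln 4" by (simp add: ln_realpow)
  finally show ?thesis by (simp add: P_def)
qed

text \<open>On each dyadic block \<open>1 / p\<close> is below the reciprocal of the left end, so by
  Chebyshev's bound the block contributes at most \<open>ln 4\<close>.\<close>

lemma sum_ln_div_primes_pow2_le:
  "(\<Sum>p | prime p \<and> p \<le> 2 ^ k. ln (real p) / real p) \<le> real k * ln 4"
proof (induction k)
  case 0
  have empty: "{p::nat. prime p \<and> p \<le> 2 ^ 0} = {}"
    by (auto dest: prime_gt_1_nat)
  show ?case unfolding empty by simp
next
  case (Suc k)
  define n :: nat where "n = 2 ^ k"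
  have n: "n > 0" by (simp add: n_def)
  define P where "P = {p. prime p \<and> n < p \<and> p \<le> 2 * n}"
  have fin: "finite P" unfolding P_def by (rule finite_subset[of _ "{..2*n}"]) auto
  have "(\<Sum>p\<in>P. ln (real p) / real p) \<le> (\<Sum>p\<in>P. ln (real p) / real n)"
  proof (rule sum_mono)
    fix p assume "p \<in> P"
    then have "n < p" by (simp add: P_def)
    then show "ln (real p) / real p \<le> ln (real p) / real n"
      using n by (intro divide_left_mono) auto
  qed
  also have "\<dots> = (\<Sum>p\<in>P. ln (real p)) / real n"
    by (simp add: sum_divide_distrib)
  also have "\<dots> \<le> ln 4"
    using sum_ln_primes_dyadic_le[OF n] n by (simp add: P_def field_simps)
  finally have "(\<Sum>p\<in>P. ln (real p) / real p) \<le> ln 4" .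
  moreover have "{p. prime p \<and> p \<le> 2 ^ Suc k} = {p. prime p \<and> p \<le> 2 ^ k} \<union> P"
    by (auto simp: P_def n_def)
  moreover have "(\<Sum>p\<in>{p. prime p \<and> p \<le> 2 ^ k} \<union> P. ln (real p) / real p) =
      (\<Sum>p | prime p \<and> p \<le> 2 ^ k. ln (real p) / real p) + (\<Sum>p\<in>P. ln (real p) / real p)"
    using fin by (intro sum.union_disjoint) (auto simp: P_def n_def)
  ultimately show ?case using Suc by (simp add: algebra_simps)
qed

lemma sum_ln_div_primes_le:
  assumes "z \<ge> (2::real)"
  shows "(\<Sum>p | prime p \<and> real p \<le> z. ln (real p) / real p) \<le> 4 * ln z"
proof -
  define k where "k = nat \<lceil>log 2 z\<rceil>"
  have lg: "log 2 z \<ge> 1" using assms by (simp add: le_log_iff)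
  have k1: "log 2 z \<le> real k" unfolding k_def by linarith
  \<comment> \<open>Rounding up at most doubles \<open>log 2 z\<close>, which is at least 1. This 2
    and \<open>ln 4 = 2 * ln 2\<close> make up the constant 4.\<close>
  have k2: "real k \<le> 2 * log 2 z" unfolding k_def using lg by linarith
  have zk: "z \<le> 2 ^ k"
    using k1 assms by (simp add: log_le_iff powr_realpow)
  have "(\<Sum>p | prime p \<and> real p \<le> z. ln (real p) / real p)
      \<le> (\<Sum>p | prime p \<and> p \<le> 2 ^ k. ln (real p) / real p)"
  proof (rule sum_mono2)
    show "{p. prime p \<and> real p \<le> z} \<subseteq> {p. prime p \<and> p \<le> 2 ^ k}"
    proof clarify
      fix p assume "real p \<le> z"
      with zk have "real p \<le> real (2 ^ k)"
        unfolding of_nat_power of_nat_numeral by linarith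
      then show "p \<le> 2 ^ k" by (simp only: of_nat_le_iff)
    qed
  qed (auto simp: Suc_le_eq prime_gt_0_nat)
  also have "\<dots> \<le> real k * ln 4" by (rule sum_ln_div_primes_pow2_le)
  also have "ln 4 = 2 * ln (2::real)"
    using ln_realpow[of 2 2] by simp
  also have "real k * (2 * ln 2) \<le> (2 * log 2 z) * (2 * ln 2)"
    using k2 by (intro mult_right_mono) auto
  also have "\<dots> = 4 * ln z" by (simp add: log_def)
  finally show ?thesis .
qed

section \<open>Sums over smooth numbers\<close>

text \<open>The cutoff \<open>y\<close> keeps the sums finite, so they can be differentiated
  termwise in the exponent.\<close>

definition smooth_upto :: "real \<Rightarrow> real \<Rightarrow> nat set" where
  "smooth_upto z y = {d. d > 0 \<and> real d \<le> y \<and> (\<forall>p. prime p \<longrightarrow> p dvd d \<longrightarrow> real p \<le> z)}"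

lemma finite_nat_le_real: "finite {d::nat. real d \<le> y}"
  by (rule finite_subset[of _ "{..nat \<lfloor>y\<rfloor>}"]) (auto simp: le_nat_floor)

lemma finite_smooth_upto [simp]: "finite (smooth_upto z y)"
  unfolding smooth_upto_def
  by (rule finite_subset[OF _ finite_nat_le_real[of y]]) auto

lemma sum_inverse_le_ln:
  assumes "y \<ge> 1"
  shows "(\<Sum>d | d > 0 \<and> real d \<le> y. 1 / real d) \<le> 1 + ln y"
proof -
  define n where "n = nat \<lfloor>y\<rfloor>"
  have n: "n \<ge> 1" "real n \<le> y" using assms unfolding n_def by linarith+
  have "{d. d > 0 \<and> real d \<le> y} = {1..n}"
    using assms by (auto simp: n_def le_nat_floor) (simp add: le_nat_iff le_floor_iff)
  then have "(\<Sum>d | d > 0 \<and> real d \<le> y. 1 / real d) = harm n"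
    by (simp add: harm_def inverse_eq_divide)
  \<comment> \<open>\<open>harm n - ln n\<close> is decreasing in \<open>n\<close> and equals 1 at
    \<open>n = 1\<close>.\<close>
  also have "\<dots> \<le> 1 + ln (real n)"
    using euler_mascheroni_sequence_decreasing[of 1 n] n by (simp add: harm_expand)
  also have "ln (real n) \<le> ln y" using n by simp
  finally show ?thesis by simp
qed

text \<open>The index set is the same for all \<open>d\<close>, which permits interchanging the sums
  over \<open>d\<close> and \<open>p\<close> later.\<close>

lemma ln_eq_sum_multiplicity:
  assumes "d \<in> smooth_upto z y"
  shows "ln (real d) = (\<Sum>p | prime p \<and> real p \<le> z. real (multiplicity p d) * ln (real p))"
proof -
  have d: "d > 0" "\<And>p. prime p \<Longrightarrow> p dvd d \<Longrightarrow> real p \<le> z"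
    using assms by (auto simp: smooth_upto_def)
  have "real d = (\<Prod>p\<in>prime_factors d. real p ^ multiplicity p d)"
    by (subst prime_factorization_nat[OF d(1)]) simp
  then have "ln (real d) = ln (\<Prod>p\<in>prime_factors d. real p ^ multiplicity p d)"
    by (rule arg_cong)
  also have "\<dots> = (\<Sum>p\<in>prime_factors d. ln (real p ^ multiplicity p d))"
    by (rule ln_prod) (auto simp: in_prime_factors_iff prime_gt_0_nat)
  also have "\<dots> = (\<Sum>p\<in>prime_factors d. real (multiplicity p d) * ln (real p))"
    by (intro sum.cong) (auto simp: ln_realpow in_prime_factors_iff prime_gt_0_nat)
  also have "\<dots> = (\<Sum>p | prime p \<and> real p \<le> z. real (multiplicity p d) * ln (real p))"
  proof (rule sum.mono_neutral_left)
    show "finite {p::nat. prime p \<and> real p \<le> z}"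
      by (rule finite_subset[OF _ finite_nat_le_real[of z]]) auto
    show "\<forall>i\<in>{p. prime p \<and> real p \<le> z} - prime_factors d. real (multiplicity i d) * ln (real i) = 0"
      using d(1) by (auto simp: in_prime_factors_iff not_dvd_imp_multiplicity_0)
  qed (use d in \<open>auto simp: in_prime_factors_iff\<close>)
  finally show ?thesis .
qed

text \<open>Splitting off one factor \<open>p\<close> bounds the left-hand side \<open>V\<close> by \<open>p\<^sup>t\<^sup>-\<^sup>1 (V + G)\<close>,
  where \<open>G\<close> is the sum on the right.\<close>

lemma sum_multiplicity_smooth_le:
  fixes t :: real
  assumes "prime p" "t \<le> 1 / 4"
  shows "(\<Sum>d\<in>smooth_upto z y. real d powr (t - 1) * real (multiplicity p d))
    \<le> 3 * real p powr (t - 1) * (\<Sum>d\<in>smooth_upto z y. real d powr (t - 1))"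
proof -
  define M where "M = smooth_upto z y"
  define G where "G = (\<Sum>d\<in>M. real d powr (t - 1))"
  define V where "V = (\<Sum>d\<in>M. real d powr (t - 1) * real (multiplicity p d))"
  define r where "r = real p powr (t - 1)"
  have p: "p > 0" "p \<ge> 2" using assms(1) by (auto simp: prime_gt_0_nat prime_ge_2_nat)
  have V0: "V \<ge> 0" and G0: "G \<ge> 0" unfolding V_def G_def by (auto intro!: sum_nonneg)
  have "V = (\<Sum>d\<in>{d\<in>M. p dvd d}. real d powr (t - 1) * real (multiplicity p d))"
    unfolding V_def by (rule sum.mono_neutral_right) (auto simp: M_def not_dvd_imp_multiplicity_0)
  also have "\<dots> = (\<Sum>e\<in>{e. p * e \<in> M}. real (p * e) powr (t - 1) * real (multiplicity p (p * e)))"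
    using p by (intro sum.reindex_bij_witness[of _ "\<lambda>e. p * e" "\<lambda>d. d div p"]) auto
  also have "\<dots> = (\<Sum>e\<in>{e. p * e \<in> M}. r * (real e powr (t - 1) * (real (multiplicity p e) + 1)))"
  proof (intro sum.cong refl)
    fix e assume "e \<in> {e. p * e \<in> M}"
    then have "e \<noteq> 0" by (auto simp: M_def smooth_upto_def)
    then have "multiplicity p (p * e) = Suc (multiplicity p e)"
      using assms(1) p by (intro multiplicity_times_same) auto
    then show "real (p * e) powr (t - 1) * real (multiplicity p (p * e)) =
        r * (real e powr (t - 1) * (real (multiplicity p e) + 1))"
      by (simp add: r_def powr_mult)
  qed
  also have "\<dots> \<le> (\<Sum>e\<in>M. r * (real e powr (t - 1) * (real (multiplicity p e) + 1)))"
  proof (rule sum_mono2)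
    show "{e. p * e \<in> M} \<subseteq> M"
    proof clarify
      fix e assume e: "p * e \<in> M"
      have "real e \<le> real (p * e)" unfolding of_nat_le_iff using p by simp
      also have "\<dots> \<le> y"
        using e by (simp only: M_def smooth_upto_def mem_Collect_eq)
      finally have "real e \<le> y" .
      with e show "e \<in> M" by (auto simp: M_def smooth_upto_def)
    qed
  qed (auto simp: M_def r_def)
  also have "\<dots> = r * (V + G)"
    by (simp add: V_def G_def sum_distrib_left sum.distrib algebra_simps)
  finally have VG: "V \<le> r * (V + G)" .
  \<comment> \<open>Because \<open>t \<le> 1 / 4\<close>, \<open>r\<close> is at most 2/3. Hence
    \<open>r * V\<close> is absorbed on the left, where a third of \<open>V\<close> remains.\<close>
  have "r \<le> 2 powr (t - 1)"
    unfolding r_def using p assms(2) by (intro powr_mono2') auto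
  also have "\<dots> \<le> 2 powr (-(3/4))" using assms(2) by simp
  also have "\<dots> \<le> 2 / 3"
  proof -
    have "(2 powr (-(3/4)) :: real) ^ 4 = 2 powr (-3)"
      by (simp add: powr_powr flip: powr_realpow)
    also have "\<dots> = 1 / 8" by (simp add: powr_minus)
    also have "\<dots> \<le> (2 / 3 :: real) ^ 4" by (simp add: power_divide)
    finally show ?thesis by (simp add: power_mono_iff)
  qed
  finally have "r * V \<le> 2 / 3 * V" using V0 by (intro mult_right_mono)
  with VG have "V \<le> 3 * r * G" by (simp add: algebra_simps)
  then show ?thesis by (simp add: V_def G_def r_def M_def)
qed

text \<open>Expand \<open>ln d\<close> over primes and interchange the sums. Each prime is bounded
  by \<open>sum_multiplicity_smooth_le\<close>, and \<open>p powr t \<le> z powr b\<close> leaves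
  the Mertens sum. Using \<open>b\<close> rather than \<open>t\<close> makes the factor uniform for
  \<open>t \<le> b\<close>, ready for integration.\<close>

lemma sum_smooth_ln_le:
  fixes t b :: real
  assumes "t \<le> b" "0 \<le> b" "b \<le> 1 / 4" "z \<ge> 2"
  shows "(\<Sum>d\<in>smooth_upto z y. real d powr (t - 1) * ln (real d))
    \<le> 12 * z powr b * ln z * (\<Sum>d\<in>smooth_upto z y. real d powr (t - 1))"
proof -
  define M where "M = smooth_upto z y"
  define G where "G = (\<Sum>d\<in>M. real d powr (t - 1))"
  define P where "P = {p::nat. prime p \<and> real p \<le> z}"
  have G0: "G \<ge> 0" unfolding G_def by (auto intro!: sum_nonneg)
  have "(\<Sum>d\<in>M. real d powr (t - 1) * ln (real d)) =
      (\<Sum>d\<in>M. \<Sum>p\<in>P. real d powr (t - 1) * (real (multiplicity p d) * ln (real p)))"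
    by (intro sum.cong refl) (simp add: M_def P_def ln_eq_sum_multiplicity sum_distrib_left)
  also have "\<dots> = (\<Sum>p\<in>P. \<Sum>d\<in>M. real d powr (t - 1) * (real (multiplicity p d) * ln (real p)))"
    by (rule sum.swap)
  also have "\<dots> = (\<Sum>p\<in>P. ln (real p) * (\<Sum>d\<in>M. real d powr (t - 1) * real (multiplicity p d)))"
    by (simp add: sum_distrib_left mult_ac)
  also have "\<dots> \<le> (\<Sum>p\<in>P. ln (real p) / real p * (3 * z powr b * G))"
  proof (rule sum_mono)
    fix p assume "p \<in> P"
    then have p: "prime p" "real p \<le> z" "real p \<ge> 1"
      by (auto simp: P_def Suc_le_eq prime_gt_0_nat)
    have "(\<Sum>d\<in>M. real d powr (t - 1) * real (multiplicity p d)) \<le> 3 * real p powr (t - 1) * G"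
      using sum_multiplicity_smooth_le[OF p(1), of t z y] assms by (simp add: M_def G_def)
    also have "\<dots> = 3 * (real p powr t / real p) * G"
      using p by (simp add: powr_diff)
    also have "\<dots> \<le> 3 * (z powr b / real p) * G"
    proof -
      have "real p powr t \<le> real p powr b" using p assms by (intro powr_mono) auto
      also have "\<dots> \<le> z powr b" using p assms by (intro powr_mono2) auto
      finally show ?thesis using p G0 by (intro mult_right_mono mult_left_mono divide_right_mono) auto
    qed
    finally have "ln (real p) * (\<Sum>d\<in>M. real d powr (t - 1) * real (multiplicity p d))
        \<le> ln (real p) * (3 * (z powr b / real p) * G)"
      using p by (intro mult_left_mono) auto
    then show "ln (real p) * (\<Sum>d\<in>M. real d powr (t - 1) * real (multiplicity p d))
        \<le> ln (real p) / real p * (3 * z powr b * G)" by (simp add: field_simps)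
  qed
  also have "\<dots> = (\<Sum>p\<in>P. ln (real p) / real p) * (3 * z powr b * G)"
    by (simp add: sum_distrib_right)
  also have "\<dots> \<le> (4 * ln z) * (3 * z powr b * G)"
    using sum_ln_div_primes_le[OF assms(4)] G0 by (intro mult_right_mono) (auto simp: P_def)
  finally show ?thesis by (simp add: M_def G_def mult_ac)
qed

text \<open>The bound on the logarithmic derivative in \<open>t\<close> of the sum of \<open>d\<^sup>t\<^sup>-\<^sup>1\<close> is integrated from \<open>0\<close> to \<open>b\<close>.\<close>

lemma sum_smooth_powr_le:
  fixes b :: real
  assumes "0 \<le> b" "b \<le> 1 / 4" "z \<ge> 2" "y \<ge> 1"
  shows "(\<Sum>d\<in>smooth_upto z y. real d powr (b - 1)) \<le> exp (12 * b * z powr b * ln z) * (1 + ln y)"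
proof -
  define B where "B = 12 * z powr b * ln z"
  define G where "G t = (\<Sum>d\<in>smooth_upto z y. real d powr (t - 1))" for t
  define D where "D t = (\<Sum>d\<in>smooth_upto z y. real d powr (t - 1) * ln (real d))" for t
  have der: "(G has_real_derivative D t) (at t)" for t
    unfolding G_def D_def
    by (auto intro!: derivative_eq_intros sum.cong simp: smooth_upto_def)
  \<comment> \<open>\<open>B\<close> does not depend on \<open>t\<close>, so
    \<open>exp (-(B * t))\<close> is an integrating factor for
    \<open>D t \<le> B * G t\<close>.\<close>
  have "exp (-(B * b)) * G b \<le> exp (-(B * 0)) * G 0"
  proof (rule DERIV_nonpos_imp_nonincreasing[OF assms(1)])
    fix t assume t: "0 \<le> t" "t \<le> b"
    have "((\<lambda>t. exp (-(B * t)) * G t) has_real_derivative exp (-(B * t)) * (D t - B * G t)) (at t)"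
      by (auto intro!: derivative_eq_intros der simp: algebra_simps)
    moreover have "D t \<le> B * G t"
      unfolding D_def G_def B_def using t assms by (intro sum_smooth_ln_le) auto
    then have "exp (-(B * t)) * (D t - B * G t) \<le> 0"
      by (simp add: mult_le_0_iff)
    ultimately show "\<exists>y. ((\<lambda>t. exp (-(B * t)) * G t) has_real_derivative y) (at t) \<and> y \<le> 0"
      by blast
  qed
  then have "G b \<le> exp (B * b) * G 0"
    by (simp add: exp_minus field_simps)
  also have "G 0 \<le> (\<Sum>d | d > 0 \<and> real d \<le> y. 1 / real d)"
    unfolding G_def
  proof (rule order_trans[OF _ sum_mono2])
    show "(\<Sum>d\<in>smooth_upto z y. real d powr (0 - 1)) \<le> (\<Sum>d\<in>smooth_upto z y. 1 / real d)"
      by (intro sum_mono) (auto simp: smooth_upto_def powr_minus divide_inverse)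
    show "finite {d. 0 < d \<and> real d \<le> y}"
      by (rule finite_subset[OF _ finite_nat_le_real[of y]]) auto
  qed (auto simp: smooth_upto_def)
  also have "\<dots> \<le> 1 + ln y" using assms(4) by (rule sum_inverse_le_ln)
  finally show ?thesis by (simp add: G_def B_def mult_ac)
qed

section \<open>Majorant of the divisor function by small divisors\<close>

text \<open>Choose \<open>e\<close> with \<open>q powr e = 2\<close>: the bound for rough numbers
  applies to \<open>b\<close>, and \<open>N powr e\<close> is the right-hand side.\<close>

lemma num_divisors_le_2_powr:
  fixes q :: nat and N :: real
  assumes "b > 0" "real b \<le> N" "q \<ge> 2" "\<And>p. prime p \<Longrightarrow> p dvd b \<Longrightarrow> q \<le> p"
  shows "real (num_divisors b) \<le> 2 powr (ln N / ln (real q))"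
proof -
  define e where "e = ln 2 / ln (real q)"
  have e: "e > 0" "e * ln (real q) = ln 2" using assms(3) by (auto simp: e_def)
  have "real (num_divisors b) \<le> real b powr e"
  proof (rule num_divisors_le_powr_of_rough[OF assms(1)])
    fix p assume "prime p" "p dvd b"
    then have "q \<le> p" by (rule assms(4))
    have "2 = real q powr e" using assms(3) e by (simp add: powr_def)
    also have "\<dots> \<le> real p powr e" using \<open>q \<le> p\<close> e by (intro powr_mono2) auto
    finally show "2 \<le> real p powr e" .
  qed
  also have "\<dots> \<le> N powr e" using assms e by (intro powr_mono2) auto
  also have "\<dots> = 2 powr (ln N / ln (real q))"
    using assms by (simp add: powr_def e_def mult_ac)
  finally show ?thesis .
qed

text \<open>The weights depend on \<open>N\<close>, the constant does not. Three parts of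
  \<open>g\<close> serve three ranges of \<open>q\<close>: above \<open>N powr (1 / 6)\<close>, from
  there down to \<open>exp 48\<close>, and below \<open>exp 48\<close>.\<close>

lemma divisor_function_majorant:
  obtains C :: real where "C > 0" and
    "\<And>N. N > 1 \<Longrightarrow> \<exists>g :: nat \<Rightarrow> real. (\<forall>d. 0 \<le> g d) \<and>
      (\<forall>m. 0 < m \<longrightarrow> real m \<le> N \<longrightarrow>
        real (num_divisors m) \<le> (\<Sum>d | d dvd m \<and> real d \<le> N powr (1 / 3). g d)) \<and>
      (\<Sum>d | d > 0 \<and> real d \<le> N powr (1 / 3). g d / real d) \<le> C * (1 + ln N)"
proof -
  \<comment> \<open>For small \<open>q\<close> one has \<open>a \<ge> N powr (1 / 6)\<close>, so
    \<open>N powr (1 / 24) \<le> a powr (1 / 4)\<close>; 1/4 is the largest exponent that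
    \<open>sum_smooth_powr_le\<close> admits.\<close>
  obtain K where K: "K > 0" "\<And>n. n > 0 \<Longrightarrow> real (num_divisors n) \<le> K * real n powr (1 / 24)"
    using num_divisors_le_powr[of "1 / 24"] by auto
  \<comment> \<open>\<open>2 ^ s = \<rho> ^ s * exp 1 ^ s\<close>: large divisors supply
    \<open>exp 1 ^ s\<close>, and what remains is summable over \<open>s\<close>.\<close>
  define \<rho> :: real where "\<rho> = 2 / exp 1"
  have exp1: "exp 1 > (2::real)" using e_approx_32 by (simp add: abs_if split: if_splits)
  have \<rho>: "0 < \<rho>" "\<rho> < 1" using exp1 by (auto simp: \<rho>_def)
  \<comment> \<open>Both uses of \<open>sum_smooth_powr_le\<close> have
    \<open>b * ln z = 12\<close>, so its exponent \<open>12 * b * z powr b * ln z\<close> is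
    \<open>144 * exp 12\<close>.\<close>
  define B :: real where "B = exp (144 * exp 12)"
  define R where "R = 1 / (1 - \<rho>)"
  have "R > 0" using \<rho> by (simp add: R_def)
  \<comment> \<open>One summand for each part of \<open>g\<close>; \<open>R\<close> is the sum of
    the geometric series in \<open>\<rho>\<close>.\<close>
  define C where "C = 64 + 4 * B * R + K * B"
  have "C > 0" using K(1) \<open>R > 0\<close> unfolding C_def B_def
    by (intro add_pos_pos mult_pos_pos) auto
  moreover have "\<exists>g :: nat \<Rightarrow> real. (\<forall>d. 0 \<le> g d) \<and>
      (\<forall>m. 0 < m \<longrightarrow> real m \<le> N \<longrightarrow>
        real (num_divisors m) \<le> (\<Sum>d | d dvd m \<and> real d \<le> N powr (1 / 3). g d)) \<and>
      (\<Sum>d | d > 0 \<and> real d \<le> N powr (1 / 3). g d / real d) \<le> C * (1 + ln N)"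
    if N: "N > 1" for N :: real
  proof -
    define L where "L = ln N"
    have L: "L > 0" using N by (simp add: L_def)
    define y where "y = N powr (1 / 3)"
    have y1: "y \<ge> 1" using N by (simp add: y_def ge_one_powr_ge_zero)
    have ln_y: "ln y = L / 3" using N by (simp add: y_def L_def ln_powr)
    \<comment> \<open>\<open>s\<close> will be the integer part of \<open>L / ln q\<close>;
      \<open>48 * s \<le> L\<close> keeps the exponent \<open>12 * s / L\<close> at most
      1/4.\<close>
    define T where "T = {s::nat. 1 \<le> s \<and> 48 * real s \<le> L}"
    have finT: "finite T"
      by (rule finite_subset[OF _ finite_nat_le_real[of "L / 48"]]) (auto simp: T_def)
    define M where "M s = smooth_upto (exp (L / real s)) y" for s
    define M0 where "M0 = smooth_upto (exp 48) y"
    \<comment> \<open>The exponent is chosen so that \<open>d\<^sup>1\<^sup>2\<^sup>s\<^sup>/\<^sup>L \<ge> e\<^sup>s\<close> as soon as \<open>d \<ge> y\<^sup>1\<^sup>/\<^sup>4 = e\<^sup>L\<^sup>/\<^sup>1\<^sup>2\<close>.\<close>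
    define g2 where "g2 s d = (if d \<in> M s then 4 * \<rho> ^ s * real d powr (12 * real s / L) else 0)" for s d
    define g3 where "g3 d = (if d \<in> M0 then K * real d powr (1 / 4) else 0)" for d
    define g where "g d = 64 + (\<Sum>s\<in>T. g2 s d) + g3 d" for d
    have g2: "g2 s d \<ge> 0" for s d using \<rho> by (simp add: g2_def)
    have g3: "g3 d \<ge> 0" for d using K(1) by (simp add: g3_def)
    have g_64: "g d \<ge> 64" for d unfolding g_def using g2 g3 by (simp add: sum_nonneg)
    then have g_0: "g d \<ge> 0" for d by (meson order_trans zero_le_numeral)
    have g_g2: "g d \<ge> g2 s d" if "s \<in> T" for s d
    proof -
      have "g2 s d \<le> (\<Sum>s\<in>T. g2 s d)" using that finT g2 by (intro member_le_sum) auto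
      then show ?thesis unfolding g_def using g3[of d] by linarith
    qed
    have g_g3: "g d \<ge> g3 d" for d
      unfolding g_def using g2 by (simp add: sum_nonneg)

    have "real (num_divisors m) \<le> (\<Sum>d | d dvd m \<and> real d \<le> y. g d)"
      if m: "m > 0" "real m \<le> N" for m
    proof -
      define D where "D = {d. d dvd m \<and> real d \<le> y}"
      have finD: "finite D" unfolding D_def
        by (rule finite_subset[OF _ finite_divisors[OF m(1)]]) auto
      obtain a b where ab: "m = a * b" and ay: "real a \<le> y" and
        ord: "\<And>p q. prime p \<Longrightarrow> prime q \<Longrightarrow> p dvd a \<Longrightarrow> q dvd b \<Longrightarrow> p \<le> q" and
        alt: "b = 1 \<or> (\<exists>q. prime q \<and> q dvd b \<and> (\<forall>p. prime p \<longrightarrow> p dvd b \<longrightarrow> q \<le> p) \<and> y < real (a * q))"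
        using maximal_prime_prefix[OF m(1) y1] by blast
      have a0: "a > 0" and b0: "b > 0" using ab m(1) by auto
      have le_y: "real d \<le> y" if "d dvd a" for d
      proof -
        have "d \<le> a" using that a0 by (rule dvd_imp_le)
        then have "real d \<le> real a" by simp
        with ay show ?thesis by linarith
      qed
      have sub: "{d. d dvd a} \<subseteq> D" using le_y by (auto simp: D_def ab)
      have le_D: "real (card E) * c \<le> sum g D" if "E \<subseteq> D" "\<And>d. d \<in> E \<Longrightarrow> c \<le> g d" for E c
      proof -
        have "real (card E) * c = (\<Sum>d\<in>E. c)" by simp
        also have "\<dots> \<le> sum g E" using that(2) by (rule sum_mono)
        also have "\<dots> \<le> sum g D" using that(1) finD g_0 by (intro sum_mono2) auto
        finally show ?thesis .
      qed
      have bounded: ?thesis if "real (num_divisors b) \<le> 64"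
      proof -
        have "real (num_divisors m) \<le> real (num_divisors a) * real (num_divisors b)"
          using num_divisors_mult_le[OF a0 b0] unfolding ab by (metis of_nat_le_iff of_nat_mult)
        also have "\<dots> \<le> real (num_divisors a) * 64"
          using that by (intro mult_left_mono) auto
        also have "\<dots> \<le> sum g D"
          unfolding num_divisors_def using sub g_64 by (rule le_D)
        finally show ?thesis by (simp add: D_def)
      qed
      show ?thesis
      proof (cases "b = 1")
        case True
        then show ?thesis by (intro bounded) simp
      next
        case False
        with alt obtain q where q: "prime q" "q dvd b" "\<And>p. prime p \<Longrightarrow> p dvd b \<Longrightarrow> q \<le> p"
          and aq: "y < real (a * q)" by blast
        have q2: "q \<ge> 2" using q(1) by (rule prime_ge_2_nat)
        have lq: "ln (real q) > 0" using q2 by simp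
        have a_le_q: "p \<le> q" if "prime p" "p dvd a" for p using ord that q(1,2) by blast
        have "real b \<le> real m" unfolding of_nat_le_iff ab using a0 by simp
        then have bq: "real (num_divisors b) \<le> 2 powr (L / ln (real q))"
          unfolding L_def using b0 m(2) q2 q(3) by (intro num_divisors_le_2_powr) auto
        show ?thesis
        proof (cases "ln (real q) > L / 6")
          case True
          \<comment> \<open>Now \<open>b\<close> has at most \<open>2 ^ 6 = 64\<close> divisors,
            which the constant part of \<open>g\<close> on the divisors of \<open>a\<close>
            covers.\<close>
          then have "L / ln (real q) \<le> 6" using lq by (simp add: field_simps)
          then have "2 powr (L / ln (real q)) \<le> 2 powr (6::real)" by (intro powr_mono) auto
          with bq show ?thesis by (intro bounded) simp
        next
          case q_small: False
          \<comment> \<open>From \<open>a * q > y\<close> and \<open>q \<le> y powr (1 / 2)\<close>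
            it follows that \<open>a\<close> is at least \<open>y powr (1 / 2)\<close>.\<close>
          have "ln y < ln (real (a * q))"
            using aq y1 a0 q2 by (subst ln_less_cancel_iff) auto
          also have "\<dots> = ln (real a) + ln (real q)"
            using a0 q2 by (simp add: ln_mult)
          finally have ln_a: "ln (real a) \<ge> L / 6" using q_small ln_y by linarith
          have smooth: "d \<in> smooth_upto z y" if "d dvd a" "real q \<le> z" for d z
            unfolding smooth_upto_def
          proof (intro CollectI conjI allI impI)
            show "d > 0" using that(1) a0 by (rule dvd_pos_nat[rotated])
            fix p assume "prime p" "p dvd d"
            then have "p \<le> q" using that by (intro a_le_q) auto
            then show "real p \<le> z" using that(2) by linarith
          qed (use that le_y in auto)
          show ?thesis
          proof (cases "ln (real q) \<ge> 48")
            case True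
            define s where "s = nat \<lfloor>L / ln (real q)\<rfloor>"
            have "L / ln (real q) \<ge> 6" using q_small lq by (simp add: field_simps)
            then have s: "real s \<le> L / ln (real q)" "L / ln (real q) \<le> real s + 1" "s \<ge> 1"
              unfolding s_def by linarith+
            have slq: "real s * ln (real q) \<le> L" using s(1) lq by (simp add: field_simps)
            have "real s * 48 \<le> real s * ln (real q)" using True by (intro mult_left_mono) auto
            then have "48 * real s \<le> L" using slq by linarith
            then have sT: "s \<in> T" using s(3) by (simp add: T_def)
            \<comment> \<open>This puts all divisors of \<open>a\<close> into \<open>M s\<close>, a
              set that depends on \<open>q\<close> only through \<open>s\<close>.\<close>
            have "ln (real q) \<le> L / real s" using slq s(3) by (simp add: field_simps)
            then have qz: "real q \<le> exp (L / real s)"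
              using q2 by (metis exp_le_cancel_iff exp_ln of_nat_0_less_iff pos2 order_less_le_trans)
            define E where "E = {d. d dvd a \<and> a \<le> d ^ 2}"
            have "real (num_divisors b) \<le> 2 powr (L / ln (real q))" by (fact bq)
            also have "\<dots> \<le> 2 powr (real s + 1)" using s(2) by (intro powr_mono) auto
            also have "\<dots> = 2 * 2 ^ s" by (simp add: powr_add powr_realpow)
            finally have db: "real (num_divisors b) \<le> 2 * 2 ^ s" .
            have "real (num_divisors m) \<le> real (num_divisors a) * real (num_divisors b)"
              using num_divisors_mult_le[OF a0 b0] unfolding ab by (metis of_nat_le_iff of_nat_mult)
            \<comment> \<open>The first 2 is the loss from keeping only large divisors, the second
              from rounding \<open>L / ln q\<close> down to \<open>s\<close>. Together they are the
              4 in \<open>g2\<close>.\<close>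
            also have "\<dots> \<le> (2 * real (card E)) * (2 * 2 ^ s)"
            proof (rule mult_mono)
              show "real (num_divisors a) \<le> 2 * real (card E)"
                using num_divisors_le_large_divisors[OF a0] unfolding E_def by linarith
            qed (use db in auto)
            also have "\<dots> = real (card E) * (4 * 2 ^ s)" by simp
            also have "\<dots> \<le> sum g D"
            proof (rule le_D)
              show "E \<subseteq> D" using sub by (auto simp: E_def)
              fix d assume "d \<in> E"
              then have d: "d dvd a" "a \<le> d ^ 2" by (auto simp: E_def)
              then have d0: "d > 0" using a0 by (auto intro: Nat.gr0I)
              have "L / 6 \<le> ln (real a)" by (fact ln_a)
              also have "\<dots> \<le> ln (real (d ^ 2))" using d(2) a0 d0 by (subst ln_le_cancel_iff) auto
              also have "\<dots> = 2 * ln (real d)" using d0 by (simp add: ln_realpow)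
              finally have "real s \<le> 12 * real s / L * ln (real d)"
                using L s(3) by (simp add: field_simps)
              then have "exp 1 ^ s \<le> real d powr (12 * real s / L)"
                using d0 by (simp add: powr_def flip: exp_of_nat_mult)
              then have "4 * \<rho> ^ s * exp 1 ^ s \<le> 4 * \<rho> ^ s * real d powr (12 * real s / L)"
                using \<rho> by (intro mult_left_mono) auto
              also have "\<dots> = g2 s d"
                using smooth[OF d(1) qz] by (simp add: g2_def M_def)
              also have "\<dots> \<le> g d" using sT by (rule g_g2)
              finally show "4 * 2 ^ s \<le> g d" by (simp add: \<rho>_def power_divide)
            qed
            finally show ?thesis by (simp add: D_def)
          next
            case False
            then have qz: "real q \<le> exp 48"
              using q2 by (metis exp_le_cancel_iff exp_ln of_nat_0_less_iff pos2 order_less_le_trans linear)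
            \<comment> \<open>For bounded \<open>q\<close> the single divisor \<open>a\<close>
              already carries enough weight, through \<open>g3\<close>.\<close>
            have "real (num_divisors m) \<le> K * real m powr (1 / 24)" by (rule K(2)[OF m(1)])
            also have "\<dots> \<le> K * N powr (1 / 24)"
              using K(1) m by (intro mult_left_mono powr_mono2) auto
            also have "\<dots> \<le> K * real a powr (1 / 4)"
              using K(1) ln_a a0 N by (intro mult_left_mono) (auto simp: powr_def L_def)
            also have "\<dots> = g3 a"
              using smooth[OF dvd_refl qz] by (simp add: g3_def M0_def)
            also have "\<dots> \<le> g a" by (rule g_g3)
            also have "\<dots> \<le> sum g D"
              using sub finD g_0 by (intro member_le_sum) auto
            finally show ?thesis by (simp add: D_def)
          qed
        qed
      qed
    qed

    moreover have "(\<Sum>d | d > 0 \<and> real d \<le> y. g d / real d) \<le> C * (1 + ln N)"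
    proof -
      define U where "U = {d::nat. d > 0 \<and> real d \<le> y}"
      have finU: "finite U" unfolding U_def
        by (rule finite_subset[OF _ finite_nat_le_real[of y]]) auto
      have sub: "smooth_upto z y \<subseteq> U" for z by (auto simp: U_def smooth_upto_def)
      have part: "(\<Sum>d\<in>U. (if d \<in> smooth_upto z y then c * real d powr t else 0) / real d)
          = c * (\<Sum>d\<in>smooth_upto z y. real d powr (t - 1))" for z c t :: real
      proof -
        have "(\<Sum>d\<in>U. (if d \<in> smooth_upto z y then c * real d powr t else 0) / real d)
            = (\<Sum>d\<in>smooth_upto z y. c * real d powr t / real d)"
          using sub[of z] finU by (intro sum.mono_neutral_cong_right) auto
        also have "\<dots> = (\<Sum>d\<in>smooth_upto z y. c * real d powr (t - 1))"
          by (intro sum.cong) (auto simp: powr_diff smooth_upto_def)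
        finally show ?thesis by (simp add: sum_distrib_left)
      qed
      have ly: "1 + ln y \<le> 1 + L" "0 \<le> 1 + ln y" using ln_y L by auto
      have p1: "(\<Sum>d\<in>U. 64 / real d) \<le> 64 * (1 + L)"
        using sum_inverse_le_ln[OF y1] ly
        by (simp add: U_def sum_distrib_left[symmetric] divide_inverse)
      have p2: "(\<Sum>d\<in>U. g2 s d / real d) \<le> 4 * B * (1 + L) * \<rho> ^ s" if "s \<in> T" for s
      proof -
        have s: "s \<ge> 1" "48 * real s \<le> L" using that by (auto simp: T_def)
        have Ls: "L / real s \<ge> 48" using s by (simp add: field_simps)
        then have "exp (L / real s) \<ge> 2"
          using exp_ge_add_one_self[of "L / real s"] by linarith
        then have "(\<Sum>d\<in>M s. real d powr (12 * real s / L - 1)) \<le>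
            exp (12 * (12 * real s / L) * exp (L / real s) powr (12 * real s / L) * ln (exp (L / real s))) * (1 + ln y)"
          unfolding M_def using s L y1 by (intro sum_smooth_powr_le) (auto simp: field_simps)
        also have "exp (L / real s) powr (12 * real s / L) = exp 12"
          using s L by (simp add: powr_def)
        also have "12 * (12 * real s / L) * exp 12 * ln (exp (L / real s)) = 144 * exp 12"
          using s L by simp
        also have "exp (144 * exp 12) * (1 + ln y) \<le> B * (1 + L)"
          unfolding B_def using ly by (intro mult_left_mono) auto
        finally have "4 * \<rho> ^ s * (\<Sum>d\<in>M s. real d powr (12 * real s / L - 1)) \<le> 4 * \<rho> ^ s * (B * (1 + L))"
          using \<rho> by (intro mult_left_mono) auto
        then show ?thesis unfolding g2_def M_def part by (simp add: mult_ac)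
      qed
      have p3: "(\<Sum>d\<in>U. g3 d / real d) \<le> K * B * (1 + L)"
      proof -
        have "exp 48 \<ge> (2::real)"
          using exp_ge_add_one_self[of "48::real"] by linarith
        then have "(\<Sum>d\<in>M0. real d powr (1 / 4 - 1)) \<le>
            exp (12 * (1 / 4) * exp 48 powr (1 / 4) * ln (exp 48)) * (1 + ln y)"
          unfolding M0_def using y1 by (intro sum_smooth_powr_le) auto
        also have "exp 48 powr (1 / 4) = exp (12::real)" by (simp add: powr_def)
        also have "12 * (1 / 4) * exp 12 * ln (exp 48) = 144 * exp (12::real)" by simp
        also have "exp (144 * exp 12) * (1 + ln y) \<le> B * (1 + L)"
          unfolding B_def using ly by (intro mult_left_mono) auto
        finally have "K * (\<Sum>d\<in>M0. real d powr (1 / 4 - 1)) \<le> K * (B * (1 + L))"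
          using K(1) by (intro mult_left_mono) auto
        then show ?thesis unfolding g3_def M0_def part by (simp add: mult_ac)
      qed
      have "(\<Sum>d\<in>U. g d / real d) =
          (\<Sum>d\<in>U. 64 / real d) + (\<Sum>d\<in>U. \<Sum>s\<in>T. g2 s d / real d) + (\<Sum>d\<in>U. g3 d / real d)"
        by (simp add: g_def add_divide_distrib sum.distrib sum_divide_distrib)
      also have "(\<Sum>d\<in>U. \<Sum>s\<in>T. g2 s d / real d) = (\<Sum>s\<in>T. \<Sum>d\<in>U. g2 s d / real d)"
        by (rule sum.swap)
      also have "\<dots> \<le> (\<Sum>s\<in>T. 4 * B * (1 + L) * \<rho> ^ s)" by (intro sum_mono p2)
      also have "\<dots> = 4 * B * (1 + L) * (\<Sum>s\<in>T. \<rho> ^ s)" by (simp add: sum_distrib_left)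
      also have "\<dots> \<le> 4 * B * (1 + L) * R"
      proof (intro mult_left_mono)
        have "(\<Sum>s\<in>T. \<rho> ^ s) \<le> (\<Sum>s. \<rho> ^ s)"
          using \<rho> finT by (intro sum_le_suminf summable_geometric) auto
        also have "\<dots> = 1 / (1 - \<rho>)" using \<rho> by (intro suminf_geometric) auto
        finally show "(\<Sum>s\<in>T. \<rho> ^ s) \<le> R" by (simp add: R_def)
      qed (use L in \<open>auto simp: B_def\<close>)
      finally have "(\<Sum>d\<in>U. g d / real d) \<le> 64 * (1 + L) + 4 * B * (1 + L) * R + K * B * (1 + L)"
        using p1 p3 by linarith
      also have "\<dots> = C * (1 + L)" unfolding C_def by (simp add: algebra_simps)
      finally show ?thesis by (simp add: U_def L_def)
    qed
    ultimately show ?thesis using g_0 unfolding y_def by blast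
  qed
  ultimately show ?thesis by (rule that)
qed

section \<open>Counting common solutions of three congruences\<close>

lemma ndiv_eq_num_divisors: "m \<noteq> 0 \<Longrightarrow> ndiv m = num_divisors (nat \<bar>m\<bar>)"
  unfolding ndiv_def num_divisors_def
  by (rule arg_cong[of _ _ card]) (auto simp: nat_abs_dvd_iff int_dvd_int_iff nat_dvd_iff intro: Nat.gr0I)

text \<open>Members of one class modulo \<open>l\<close> are determined by their quotients by
  \<open>l\<close>; the possible quotient 0 accounts for the summand 1.\<close>

lemma card_residue_class_le:
  fixes x :: real and l r :: int
  assumes "l > 0" "x \<ge> 0"
  shows "real (card {n::int. 1 \<le> n \<and> real_of_int n \<le> x \<and> l dvd n - r}) \<le> x / real_of_int l + 1"
proof -
  define A where "A = {n::int. 1 \<le> n \<and> real_of_int n \<le> x \<and> l dvd n - r}"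
  have "card A \<le> card {0..\<lfloor>x\<rfloor> div l}"
  proof (rule card_inj_on_le[of "\<lambda>n. n div l"])
    show "inj_on (\<lambda>n. n div l) A"
    proof (rule inj_onI)
      fix m n assume "m \<in> A" "n \<in> A" and eq: "m div l = n div l"
      then have "m mod l = n mod l"
        by (auto simp: A_def mod_eq_dvd_iff[symmetric])
      with eq show "m = n" by (metis div_mult_mod_eq)
    qed
    show "(\<lambda>n. n div l) ` A \<subseteq> {0..\<lfloor>x\<rfloor> div l}"
      using assms(1) by (auto simp: A_def pos_imp_zdiv_nonneg_iff le_floor_iff intro!: zdiv_mono1)
  qed simp
  also have "real (card {0..\<lfloor>x\<rfloor> div l}) = real_of_int (\<lfloor>x\<rfloor> div l) + 1"
    using assms by (simp add: pos_imp_zdiv_nonneg_iff)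
  also have "real_of_int (\<lfloor>x\<rfloor> div l) \<le> real_of_int \<lfloor>x\<rfloor> / real_of_int l"
    by (rule real_of_int_div4)
  also have "\<dots> \<le> x / real_of_int l"
    using assms(1) by (intro divide_right_mono) auto
  finally show ?thesis by (simp add: A_def)
qed

text \<open>The pairwise gcds divide the differences \<open>h\<close>, \<open>h\<close> and
  \<open>2 * h\<close> of the three shifts, so passing from the product to the lcm loses at most
  \<open>h * (h * (2 * h))\<close>.\<close>

lemma prod_le_lcm_of_common_solution:
  fixes d1 d2 d3 n h :: int
  assumes "h > 0" "d1 > 0" "d2 > 0" "d3 > 0" "d1 dvd n" "d2 dvd n - h" "d3 dvd n + h"
  shows "d1 * d2 * d3 \<le> 2 * h ^ 3 * lcm (lcm d1 d2) d3"
proof -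
  have g12: "gcd d1 d2 dvd h"
  proof -
    have "gcd d1 d2 dvd n - (n - h)" using assms by (meson dvd_diff dvd_trans gcd_dvd1 gcd_dvd2)
    then show ?thesis by simp
  qed
  have g13: "gcd d1 d3 dvd h"
  proof -
    have "gcd d1 d3 dvd (n + h) - n" using assms by (meson dvd_diff dvd_trans gcd_dvd1 gcd_dvd2)
    then show ?thesis by simp
  qed
  have g23: "gcd d2 d3 dvd 2 * h"
  proof -
    have "gcd d2 d3 dvd (n + h) - (n - h)" using assms by (meson dvd_diff dvd_trans gcd_dvd1 gcd_dvd2)
    then show ?thesis by simp
  qed
  define l where "l = lcm d1 d2"
  have l: "l > 0" "lcm l d3 > 0" using assms by (auto simp: l_def lcm_pos_int)
  have "gcd l d3 dvd gcd d1 d3 * gcd d2 d3"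
  proof -
    \<comment> \<open>Hence \<open>gcd l d3\<close> splits into a divisor of \<open>d1\<close> and
      one of \<open>d2\<close>, both of which divide \<open>d3\<close>.\<close>
    have "gcd l d3 dvd d1 * d2"
      unfolding l_def by (meson dvd_trans gcd_dvd1 lcm_least dvd_triv_left dvd_triv_right)
    then obtain u v where uv: "gcd l d3 = u * v" "u dvd d1" "v dvd d2"
      using division_decomp by blast
    then have "u dvd d3" "v dvd d3"
      by (metis dvd_trans gcd_dvd2 dvd_triv_left dvd_triv_right)+
    then show ?thesis using uv by (simp add: mult_dvd_mono)
  qed
  also have "\<dots> dvd h * (2 * h)" using g13 g23 by (rule mult_dvd_mono)
  finally have g3: "gcd l d3 \<le> h * (2 * h)" using assms(1) by (intro zdvd_imp_le) auto
  have g12': "gcd d1 d2 \<le> h" using g12 assms(1) by (intro zdvd_imp_le) auto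
  have "d1 * d2 = gcd d1 d2 * l"
    using assms prod_gcd_lcm_int[of d1 d2] by (simp add: l_def)
  then have "d1 * d2 * d3 = gcd d1 d2 * (l * d3)" by simp
  also have "l * d3 = gcd l d3 * lcm l d3"
    using assms l prod_gcd_lcm_int[of l d3] by simp
  also have "gcd d1 d2 * (gcd l d3 * lcm l d3) \<le> h * ((h * (2 * h)) * lcm l d3)"
    using g3 g12' assms l by (intro mult_mono) auto
  finally show ?thesis by (simp add: l_def power3_eq_cube mult_ac)
qed

text \<open>Given one solution \<open>r\<close>, all solutions are congruent to \<open>r\<close>
  modulo the lcm \<open>l\<close>. As \<open>l \<le> d1 * d2 * d3 \<le> N\<close>, the summand 1 in
  the class count is absorbed, giving \<open>2 * N / l\<close>.\<close>

lemma card_common_solutions_le: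
  fixes x N :: real and h :: int and d1 d2 d3 :: nat
  assumes "h > 0" "d1 > 0" "d2 > 0" "d3 > 0" "real (d1 * d2 * d3) \<le> N" "0 \<le> x" "x \<le> N"
  shows "real (card {n::int. 1 \<le> n \<and> real_of_int n \<le> x \<and>
            int d1 dvd n \<and> int d2 dvd n - h \<and> int d3 dvd n + h})
    \<le> 4 * real_of_int h ^ 3 * N / (real d1 * real d2 * real d3)"
proof -
  define A where "A = {n::int. 1 \<le> n \<and> real_of_int n \<le> x \<and>
            int d1 dvd n \<and> int d2 dvd n - h \<and> int d3 dvd n + h}"
  show ?thesis
  proof (cases "A = {}")
    case True
    then show ?thesis using assms unfolding A_def[symmetric] by simp
  next
    case False
    then obtain r where r: "int d1 dvd r" "int d2 dvd r - h" "int d3 dvd r + h"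
      by (auto simp: A_def)
    define l where "l = lcm (lcm (int d1) (int d2)) (int d3)"
    have l: "l > 0" using assms unfolding l_def by (intro lcm_pos_int) auto
    have sub: "A \<subseteq> {n::int. 1 \<le> n \<and> real_of_int n \<le> x \<and> l dvd n - r}"
    proof clarify
      fix n assume n: "n \<in> A"
      have "int d1 dvd n - r" using n r by (auto simp: A_def)
      moreover have "int d2 dvd (n - h) - (r - h)" "int d3 dvd (n + h) - (r + h)"
        using n r unfolding A_def by (blast intro: dvd_diff)+
      ultimately have "l dvd n - r"
        unfolding l_def by (intro lcm_least) simp_all
      then show "1 \<le> n \<and> real_of_int n \<le> x \<and> l dvd n - r"
        using n by (simp add: A_def)
    qed
    have fin: "finite {n::int. 1 \<le> n \<and> real_of_int n \<le> x \<and> l dvd n - r}"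
      by (rule finite_subset[of _ "{1..\<lfloor>x\<rfloor>}"]) (auto simp: le_floor_iff)
    have "l dvd int d1 * int d2 * int d3"
      unfolding l_def by (intro lcm_least) auto
    then have "l \<le> int d1 * int d2 * int d3"
      using assms by (intro zdvd_imp_le) auto
    then have "real_of_int l \<le> real_of_int (int d1 * int d2 * int d3)"
      by (simp only: of_int_le_iff)
    also have "\<dots> = real (d1 * d2 * d3)" by simp
    finally have "real_of_int l \<le> real (d1 * d2 * d3)" .
    with assms have lN: "real_of_int l \<le> N" by linarith
    have "int d1 * int d2 * int d3 \<le> 2 * h ^ 3 * l"
      unfolding l_def using assms r by (intro prod_le_lcm_of_common_solution) auto
    then have "real_of_int (int d1 * int d2 * int d3) \<le> real_of_int (2 * h ^ 3 * l)"
      by (simp only: of_int_le_iff)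
    then have low: "real d1 * real d2 * real d3 \<le> 2 * real_of_int h ^ 3 * real_of_int l" by simp
    have "real (card A) \<le> real (card {n::int. 1 \<le> n \<and> real_of_int n \<le> x \<and> l dvd n - r})"
      using sub fin by (simp add: card_mono)
    also have "\<dots> \<le> x / real_of_int l + 1" using l assms by (intro card_residue_class_le) auto
    also have "\<dots> = (x + real_of_int l) / real_of_int l" using l by (simp add: add_divide_distrib)
    also have "\<dots> \<le> 2 * N / real_of_int l" using l lN assms by (intro divide_right_mono) auto
    also have "\<dots> \<le> 4 * real_of_int h ^ 3 * N / (real d1 * real d2 * real d3)"
    proof -
      have "2 * N * (real d1 * real d2 * real d3) \<le> 2 * N * (2 * real_of_int h ^ 3 * real_of_int l)"
        using low assms by (intro mult_left_mono) auto
      then show ?thesis using l assms by (simp add: field_simps)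
    qed
    finally show ?thesis by (simp add: A_def)
  qed
qed

section \<open>Summing over the three shifts\<close>

theorem theorem1p2:
  fixes h :: int
  assumes "h > 0"
  shows "\<exists>C>0. \<forall>\<^sub>F x in at_top. S x h \<le> C * x * (ln x) ^ 3"
proof -
  obtain C where C: "C > 0" and major: "\<And>N. N > 1 \<Longrightarrow> \<exists>g :: nat \<Rightarrow> real. (\<forall>d. 0 \<le> g d) \<and>
      (\<forall>m. 0 < m \<longrightarrow> real m \<le> N \<longrightarrow>
        real (num_divisors m) \<le> (\<Sum>d | d dvd m \<and> real d \<le> N powr (1 / 3). g d)) \<and>
      (\<Sum>d | d > 0 \<and> real d \<le> N powr (1 / 3). g d / real d) \<le> C * (1 + ln N)"
    using divisor_function_majorant by blast
  define c where "c = 4 * real_of_int h ^ 3"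
  have c: "c > 0" using assms by (simp add: c_def)
  \<comment> \<open>\<open>x \<ge> h\<close> gives \<open>N \<le> 2 * x\<close>, hence the 2;
    \<open>x \<ge> exp 1\<close> gives \<open>1 + ln N \<le> 3 * ln x\<close>, hence the 3.\<close>
  have "S x h \<le> (c * 2 * (C * 3) ^ 3) * x * ln x ^ 3" if x: "x \<ge> real_of_int h" "x \<ge> exp 1" for x
  proof -
    define N where "N = x + real_of_int h"
    have "exp 1 > (1::real)" by simp
    then have x1: "x > 1" using x(2) by linarith
    have h0: "real_of_int h > 0" using assms by simp
    have N1: "N > 1" and Nx: "N \<le> 2 * x" using x1 x h0 by (auto simp: N_def)
    obtain g :: "nat \<Rightarrow> real" where g0: "\<And>d. 0 \<le> g d"
      and gm: "\<And>m. 0 < m \<Longrightarrow> real m \<le> N \<Longrightarrow>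
        real (num_divisors m) \<le> (\<Sum>d | d dvd m \<and> real d \<le> N powr (1 / 3). g d)"
      and gs: "(\<Sum>d | d > 0 \<and> real d \<le> N powr (1 / 3). g d / real d) \<le> C * (1 + ln N)"
      using major[OF N1] by blast
    define y where "y = N powr (1 / 3)"
    define U where "U = {d::nat. d > 0 \<and> real d \<le> y}"
    have finU: "finite U" unfolding U_def
      by (rule finite_subset[OF _ finite_nat_le_real[of y]]) auto
    \<comment> \<open>The indicator makes the range of \<open>d\<close> independent of
      \<open>n\<close>, so that the sums can be interchanged.\<close>
    define f where "f d n = g d * of_bool (int d dvd n)" for d and n :: int
    have ndiv_le: "real (ndiv n) \<le> (\<Sum>d\<in>U. f d n)" if "n \<noteq> 0" "real_of_int \<bar>n\<bar> \<le> N" for n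
    proof -
      have "real (nat \<bar>n\<bar>) \<le> N" using that by (simp add: of_nat_nat)
      then have "real (ndiv n) \<le> (\<Sum>d | d dvd nat \<bar>n\<bar> \<and> real d \<le> y. g d)"
        using gm[of "nat \<bar>n\<bar>"] that by (simp add: ndiv_eq_num_divisors y_def)
      also have "\<dots> = (\<Sum>d\<in>{d \<in> U. int d dvd n}. g d)"
        using that by (intro sum.cong) (auto simp: U_def int_dvd_int_iff nat_abs_dvd_iff intro!: Nat.gr0I)
      also have "\<dots> = (\<Sum>d\<in>U. f d n)"
        using finU by (intro sum.mono_neutral_cong_left) (auto simp: f_def)
      finally show ?thesis .
    qed
    define I where "I = {n::int. 1 \<le> n \<and> real_of_int n \<le> x \<and> n \<noteq> h}"
    have finI: "finite I" unfolding I_def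
      by (rule finite_subset[of _ "{1..\<lfloor>x\<rfloor>}"]) (auto simp: le_floor_iff)
    have "S x h = (\<Sum>n\<in>I. real (ndiv n) * real (ndiv (n - h)) * real (ndiv (n + h)))"
      by (simp add: S_def I_def)
    also have "\<dots> \<le> (\<Sum>n\<in>I. (\<Sum>a\<in>U. f a n) * (\<Sum>b\<in>U. f b (n - h)) * (\<Sum>d\<in>U. f d (n + h)))"
    proof (rule sum_mono)
      fix n assume n: "n \<in> I"
      then have "n \<noteq> 0" "n - h \<noteq> 0" "n + h \<noteq> 0" using assms by (auto simp: I_def)
      \<comment> \<open>\<open>n - h\<close> may be negative, hence the absolute values;
        \<open>N = x + h\<close> covers all three arguments.\<close>
      moreover have "real_of_int \<bar>n\<bar> \<le> N" "real_of_int \<bar>n - h\<bar> \<le> N" "real_of_int \<bar>n + h\<bar> \<le> N"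
        using n h0 by (auto simp: I_def N_def abs_if)
      ultimately show "real (ndiv n) * real (ndiv (n - h)) * real (ndiv (n + h))
          \<le> (\<Sum>a\<in>U. f a n) * (\<Sum>b\<in>U. f b (n - h)) * (\<Sum>d\<in>U. f d (n + h))"
        using g0 by (intro mult_mono ndiv_le mult_nonneg_nonneg sum_nonneg) (auto simp: f_def)
    qed
    also have "\<dots> = (\<Sum>n\<in>I. \<Sum>d\<in>U. \<Sum>b\<in>U. \<Sum>a\<in>U. f a n * f b (n - h) * f d (n + h))"
      by (simp only: sum_product sum_distrib_right sum_distrib_left)
    also have "\<dots> = (\<Sum>d\<in>U. \<Sum>b\<in>U. \<Sum>a\<in>U. \<Sum>n\<in>I. f a n * f b (n - h) * f d (n + h))"
      by (subst sum.swap, rule sum.cong[OF refl], subst sum.swap, rule sum.cong[OF refl], rule sum.swap)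
    also have "\<dots> \<le> (\<Sum>d\<in>U. \<Sum>b\<in>U. \<Sum>a\<in>U. c * N * (g a / real a * (g b / real b) * (g d / real d)))"
    proof (intro sum_mono)
      fix d b a assume U: "d \<in> U" "b \<in> U" "a \<in> U"
      define B where "B = {n::int. 1 \<le> n \<and> real_of_int n \<le> x \<and>
            int a dvd n \<and> int b dvd n - h \<and> int d dvd n + h}"
      have finB: "finite B" unfolding B_def
        by (rule finite_subset[of _ "{1..\<lfloor>x\<rfloor>}"]) (auto simp: le_floor_iff)
      \<comment> \<open>The cube root in \<open>y\<close> is chosen for this: the product of the
        moduli stays within \<open>N\<close>, as the count requires.\<close>
      have "real a * real b * real d \<le> y * y * y"
        using U by (intro mult_mono) (auto simp: U_def)
      also have "\<dots> = N" using N1 by (simp add: y_def flip: powr_add)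
      finally have cardB: "real (card B) \<le> c * N / (real a * real b * real d)"
        unfolding B_def c_def using U assms x1 h0
        by (intro card_common_solutions_le) (auto simp: U_def N_def)
      \<comment> \<open>The three indicators leave exactly the \<open>n\<close> that solve all three
        congruences.\<close>
      have "(\<Sum>n\<in>I. f a n * f b (n - h) * f d (n + h)) = (\<Sum>n\<in>I \<inter> B. g a * g b * g d)"
        using finI by (intro sum.mono_neutral_cong_right) (auto simp: f_def B_def I_def)
      also have "\<dots> = g a * g b * g d * real (card (I \<inter> B))" by simp
      also have "\<dots> \<le> g a * g b * g d * (c * N / (real a * real b * real d))"
        using cardB card_mono[OF finB, of "I \<inter> B"] g0
        by (intro mult_left_mono) auto
      finally show "(\<Sum>n\<in>I. f a n * f b (n - h) * f d (n + h))
          \<le> c * N * (g a / real a * (g b / real b) * (g d / real d))"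
        by (simp add: mult_ac)
    qed
    also have "\<dots> = c * N * ((\<Sum>a\<in>U. g a / real a) * (\<Sum>b\<in>U. g b / real b) * (\<Sum>d\<in>U. g d / real d))"
      by (simp only: sum_product sum_distrib_right sum_distrib_left)
    also have "\<dots> = c * N * (\<Sum>d\<in>U. g d / real d) ^ 3"
      by (simp only: power3_eq_cube)
    also have "\<dots> \<le> c * (2 * x) * (C * (3 * ln x)) ^ 3"
    proof -
      have lx: "ln x \<ge> 1" using x(2) x1 by (simp add: ln_ge_iff)
      have "ln N \<le> ln (2 * x)" using Nx N1 by simp
      also have "\<dots> = ln 2 + ln x" using x1 by (simp add: ln_mult)
      finally have "1 + ln N \<le> 3 * ln x" using lx ln_2_less_1 by linarith
      then have "C * (1 + ln N) \<le> C * (3 * ln x)" using C by (intro mult_left_mono) auto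
      with gs have "(\<Sum>d\<in>U. g d / real d) \<le> C * (3 * ln x)" by (simp add: U_def y_def)
      then show ?thesis
        using c Nx N1 x1 g0 by (intro mult_mono power_mono sum_nonneg) (auto intro!: sum_nonneg)
    qed
    finally show ?thesis by (simp add: power_mult_distrib mult_ac)
  qed
  then have "\<forall>\<^sub>F x in at_top. S x h \<le> (c * 2 * (C * 3) ^ 3) * x * ln x ^ 3"
    unfolding eventually_at_top_linorder
    by (intro exI[of _ "max (real_of_int h) (exp 1)"]) auto
  then show ?thesis using c C by (intro exI[of _ "c * 2 * (C * 3) ^ 3"]) auto
qed

end
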